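(* Let $f:\mathbb{R}^d\to\mathbb{R}$ be differentiable and convex with unique minimizer $x_\star$, let $k:\mathbb{R}^d\to\mathbb{R}$ be differentiable and strictly convex with minimum $k(0)=0$, and let $\gamma\in(0,1)$. Assume there exist a differentiable, non-increasing, convex function $\alpha:[0,\infty)\to(0,1]$ and a constant $C_{\alpha,\gamma}\in(0,\gamma]$ such that $$k(p)\ge \alpha(k(p))\max\big(f_c^*(p),f_c^*(-p)\big)\quad\text{for all }p\in\mathbb{R}^d,$$ $$-C_{\alpha,\gamma}\,\alpha'(y)\,y<\alpha(y)\quad\text{for all }y\in[0,\infty).$$ Let $(x_t,p_t)_{t\ge 0}$ be a solution of $$x_t'=\nabla k(p_t),\qquad p_t'=-\nabla f(x_t)-\gamma p_t$$ with $(x_0,p_0)=(x,0)$ for some $x\in\mathbb{R}^d$. Let $\mathcal{H}_0=f(x_0)-f(x_\star)$, $\alpha_\star=\alpha(3\mathcal{H}_0)$, $\lambda=\frac{(1-\gamma)C_{\alpha,\gamma}}{4}$, and let $\mathcal{W}:[0,\infty)\to[0,\infty)$ be the solution of $$\mathcal{W}_t'=-\lambda\,\alpha(2\mathcal{W}_t)\,\mathcal{W}_t,\qquad \mathcal{W}_0=\mathcal{H}_0.$$ Then for every $t\in[0,\infty)$, $$f(x_t)-f(x_\star)\le 2\mathcal{H}_0\exp\Big(-\lambda\int_0^t\alpha(2\mathcal{W}_s)\,ds\Big)\le 2\mathcal{H}_0\exp(-\lambda\alpha_\star t).$$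
   Context: $\langle\cdot,\cdot\rangle$ is the standard inner product on $\mathbb{R}^d$. For convex $f$ with minimizer $x_\star$, the centered function is $f_c(x)=f(x+x_\star)-f(x_\star)$, and $f_c^*(p)=\sup\{\langle x,p\rangle-f_c(x):x\in\mathbb{R}^d\}$ is its convex conjugate (possibly $+\infty$). *)

theory Defs
  imports "HOL-Analysis.Analysis"
begin

definition gradient :: "('a::real_inner \<Rightarrow> real) \<Rightarrow> 'a \<Rightarrow> 'a" where
  "gradient f x = (THE D. GDERIV f x :> D)"

lemma gradient_eqI:
  assumes "GDERIV f x :> D"
  shows "gradient f x = D"
  unfolding gradient_def
proof (rule the_equality)
  show "GDERIV f x :> D" by (fact assms)
next
  fix E assume "GDERIV f x :> E"
  then have "(\<lambda>h. inner h E) = (\<lambda>h. inner h D)"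
    using assms unfolding gderiv_def by (rule has_derivative_unique)
  then have "\<forall>h. inner h E = inner h D"
    by (simp add: fun_eq_iff)
  then show "E = D"
    by (simp only: vector_eq_ldot)
qed

lemma differentiable_imp_GDERIV_gradient:
  fixes f :: "'a::euclidean_space \<Rightarrow> real"
  assumes "f differentiable (at x)"
  shows "GDERIV f x :> gradient f x"
proof -
  obtain f' where f': "(f has_derivative f') (at x)"
    using assms unfolding differentiable_def by blast
  then have lin: "linear f'"
    by (rule has_derivative_linear)
  have "f' = (\<lambda>h. inner h (adjoint f' 1))"
    using adjoint_works[OF lin, of _ 1] by (simp add: fun_eq_iff)
  then have "GDERIV f x :> adjoint f' 1"
    using f' unfolding gderiv_def by simp
  then show ?thesis
    by (simp only: gradient_eqI)
qed

definition strictly_convex_on :: "'a::real_vector set \<Rightarrow> ('a \<Rightarrow> real) \<Rightarrow> bool" where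
  "strictly_convex_on S f \<longleftrightarrow> convex S \<and>
    (\<forall>x\<in>S. \<forall>y\<in>S. \<forall>u>0. \<forall>v>0. x \<noteq> y \<and> u + v = 1 \<longrightarrow>
       f (u *\<^sub>R x + v *\<^sub>R y) < u * f x + v * f y)"

definition unique_minimizer :: "('a \<Rightarrow> real) \<Rightarrow> 'a \<Rightarrow> bool" where
  "unique_minimizer f x \<longleftrightarrow>
    is_arg_min f (\<lambda>_. True) x \<and> (\<forall>y. is_arg_min f (\<lambda>_. True) y \<longrightarrow> y = x)"

definition centered :: "('a::real_vector \<Rightarrow> real) \<Rightarrow> 'a \<Rightarrow> 'a \<Rightarrow> real" where
  "centered f x\<^sub>0 x = f (x + x\<^sub>0) - f x\<^sub>0"

definition convex_conjugate :: "('a::real_inner \<Rightarrow> real) \<Rightarrow> 'a \<Rightarrow> ereal" where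
  "convex_conjugate g p = (SUP x. ereal (inner x p - g x))"

end

(* Write F = f(x_t) - f(xs), K = k(p_t), S = <x_t - xs, p_t> and H = F + K. The natural Lyapunov
   function is defined implicitly by V = H + C/2 * alpha(2 V) * S. To avoid solving for V, the
   solution W of the comparison equation is used as a barrier instead: with
   phi = W - H - C/2 * alpha(2 W) * S, the set {phi >= 0, H <= 2 W} is forward invariant as long as
   H > 0, because on it H < 2 W strictly and phi' > 0 wherever phi = 0. Hence F <= H <= 2 W, and W
   has the stated exponential form. Once H = 0 it remains so, and the bound is trivial. *)
theory Submission
  imports Defs
begin

section \<open>Barrier principles on a real interval\<close>

lemma closed_right_open_covers_interval:
  fixes G :: "real set"
  assumes "closed G" "a \<in> G"
    and step: "\<And>s. s \<in> G \<Longrightarrow> a \<le> s \<Longrightarrow> s < b \<Longrightarrow> \<forall>\<^sub>F u in at_right s. u \<in> G"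
    and t: "t \<in> {a..b}"
  shows "t \<in> G"
proof (rule ccontr)
  assume "t \<notin> G"
  \<comment> \<open>Compactness yields the last point \<open>s\<close> of \<open>G\<close> up to
    \<open>t\<close>. It lies strictly before \<open>t\<close>, so right-openness at
    \<open>s\<close> gives a later point of \<open>G\<close> still before \<open>t\<close>, a
    contradiction.\<close>
  have "compact (G \<inter> {a..t})"
    using \<open>closed G\<close> by (simp add: closed_Int_compact)
  moreover have "G \<inter> {a..t} \<noteq> {}"
    using \<open>a \<in> G\<close> t by auto
  ultimately obtain s where s: "s \<in> G \<inter> {a..t}" and max: "\<And>u. u \<in> G \<inter> {a..t} \<Longrightarrow> u \<le> s"
    using compact_attains_sup by metis
  have "s < t" "s < b"
    using s \<open>t \<notin> G\<close> t by (auto simp: less_le)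
  then have "\<forall>\<^sub>F u in at_right s. u \<in> G"
    using step s by auto
  then obtain c where c: "s < c" "\<And>u. s < u \<Longrightarrow> u < c \<Longrightarrow> u \<in> G"
    unfolding eventually_at_right_field by blast
  obtain u where "s < u" "u < min c t"
    using dense[of s "min c t"] c(1) \<open>s < t\<close> by auto
  then show False
    using c(2)[of u] max[of u] s by auto
qed

lemma eventually_at_right_pos:
  fixes \<phi> :: "real \<Rightarrow> real"
  assumes "continuous (at s within {s..}) \<phi>" "0 < \<phi> s"
  shows "\<forall>\<^sub>F u in at_right s. 0 < \<phi> u"
proof -
  have "(\<phi> \<longlongrightarrow> \<phi> s) (at_right s)"
    using assms(1) unfolding continuous_within by (rule tendsto_within_subset) auto
  then show ?thesis
    using order_tendstoD(1) assms(2) by blast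
qed

lemma eventually_at_right_pos_deriv:
  fixes \<phi> :: "real \<Rightarrow> real"
  assumes "(\<phi> has_real_derivative d) (at s within {s..})" "0 < d" "\<phi> s = 0"
  shows "\<forall>\<^sub>F u in at_right s. 0 < \<phi> u"
proof -
  obtain e where "0 < e" "\<And>h. 0 < h \<Longrightarrow> s + h \<in> {s..} \<Longrightarrow> h < e \<Longrightarrow> \<phi> s < \<phi> (s + h)"
    using has_real_derivative_pos_inc_right[OF assms(1,2)] by blast
  then have "\<phi> u > 0" if "s < u" "u < s + e" for u
    using that assms(3) by (metis add.commute add_less_cancel_left atLeast_iff diff_add_cancel
        diff_gt_0_iff_gt less_imp_le)
  then show ?thesis
    unfolding eventually_at_right_field using \<open>0 < e\<close> by (intro exI[of _ "s + e"]) auto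
qed

text \<open>The two conditions are propagated together because each relies on the other:
  \<open>gap\<close> needs both functions nonnegative, and \<open>deriv\<close> needs \<psi>
  positive. On the closed set where both are nonnegative, \<psi> is strictly positive and stays so
  to the right by continuity, while \<phi> is either positive or zero with positive derivative. The
  set is thus open to the right and covers the whole interval.\<close>

lemma coupled_barrier:
  fixes \<phi> \<psi> :: "real \<Rightarrow> real"
  assumes cont: "continuous_on {a..} \<phi>" "continuous_on {a..} \<psi>"
    and init: "0 \<le> \<phi> a" "0 \<le> \<psi> a"
    and gap: "\<And>s. a \<le> s \<Longrightarrow> s < b \<Longrightarrow> 0 \<le> \<phi> s \<Longrightarrow> 0 \<le> \<psi> s \<Longrightarrow> 0 < \<psi> s"
    and deriv: "\<And>s. a \<le> s \<Longrightarrow> s < b \<Longrightarrow> \<phi> s = 0 \<Longrightarrow> 0 < \<psi> s \<Longrightarrow>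
      \<exists>d>0. (\<phi> has_real_derivative d) (at s within {a..})"
    and t: "t \<in> {a..b}"
  shows "0 \<le> \<phi> t \<and> 0 \<le> \<psi> t"
proof -
  let ?G = "{s \<in> {a..}. 0 \<le> \<phi> s} \<inter> {s \<in> {a..}. 0 \<le> \<psi> s}"
  have "t \<in> ?G"
  proof (rule closed_right_open_covers_interval[OF _ _ _ t])
    show "closed ?G"
      by (intro closed_Int continuous_on_closed_Collect_le continuous_on_const cont closed_atLeast)
    show "a \<in> ?G"
      using init by auto
    fix s assume "s \<in> ?G" "a \<le> s" "s < b"
    then have s: "0 \<le> \<phi> s" "0 < \<psi> s"
      using gap by auto
    have sub: "{s..} \<subseteq> {a..}"
      using \<open>a \<le> s\<close> by auto
    have c: "continuous (at s within {s..}) \<phi>" "continuous (at s within {s..}) \<psi>"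
      using cont \<open>a \<le> s\<close> continuous_within_subset[OF _ sub]
      by (auto simp: continuous_on_eq_continuous_within)
    have "\<forall>\<^sub>F u in at_right s. 0 < \<phi> u"
    proof (cases "\<phi> s = 0")
      case True
      then obtain d where "0 < d" "(\<phi> has_real_derivative d) (at s within {a..})"
        using deriv \<open>a \<le> s\<close> \<open>s < b\<close> s(2) by blast
      then show ?thesis
        using True eventually_at_right_pos_deriv DERIV_subset[OF _ sub] by blast
    qed (use c s eventually_at_right_pos in auto)
    moreover have "\<forall>\<^sub>F u in at_right s. 0 < \<psi> u"
      using c s eventually_at_right_pos by auto
    moreover have "\<forall>\<^sub>F u in at_right s. s < u"
      by (rule eventually_at_right_less)
    ultimately show "\<forall>\<^sub>F u in at_right s. u \<in> ?G"
      by eventually_elim (use \<open>a \<le> s\<close> in auto)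
  qed
  then show ?thesis
    by auto
qed

section \<open>Convexity, gradients and conjugates\<close>

lemma convex_on_imp_above_tangent_GDERIV:
  fixes g :: "'a::real_inner \<Rightarrow> real"
  assumes "convex_on UNIV g" "GDERIV g x :> D"
  shows "g x + inner (y - x) D \<le> g y"
proof -
  \<comment> \<open>Restricting \<open>g\<close> to the line with \<open>l 0 = x\<close> and
    \<open>l 1 = y\<close> reduces the claim to the tangent inequality for a convex function of one
    real variable.\<close>
  define l where "l s = x + s *\<^sub>R (y - x)" for s :: real
  have "convex_on UNIV (\<lambda>s. g (l s))"
  proof (rule convex_onI)
    fix t a b :: real assume "0 < t" "t < 1"
    moreover have "l ((1 - t) *\<^sub>R a + t *\<^sub>R b) = (1 - t) *\<^sub>R l a + t *\<^sub>R l b"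
      unfolding l_def by (simp add: algebra_simps)
    ultimately show "g (l ((1 - t) *\<^sub>R a + t *\<^sub>R b)) \<le> (1 - t) * g (l a) + t * g (l b)"
      using convex_onD[OF assms(1), of t "l a" "l b"] by simp
  qed simp
  moreover have "((\<lambda>s. g (l s)) has_real_derivative inner (y - x) D) (at 0 within UNIV)"
  proof -
    have l: "(l has_derivative (\<lambda>s. s *\<^sub>R (y - x))) (at 0)"
      unfolding l_def by (auto intro!: derivative_eq_intros)
    have "(g has_derivative (\<lambda>h. inner h D)) (at (l 0))"
      using assms(2) by (simp add: gderiv_def l_def)
    from has_derivative_compose[OF l this] show ?thesis
      by (simp add: has_field_derivative_def mult_commute_abs)
  qed
  ultimately have "g (l 1) - g (l 0) \<ge> inner (y - x) D * (1 - 0)"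
    by (intro convex_on_imp_above_tangent[where A = UNIV]) auto
  then show ?thesis
    by (simp add: l_def)
qed

lemma strictly_convex_on_imp_convex_on:
  assumes "strictly_convex_on S g"
  shows "convex_on S g"
proof (rule convex_onI)
  fix t :: real and x y assume "0 < t" "t < 1" "x \<in> S" "y \<in> S"
  then show "g ((1 - t) *\<^sub>R x + t *\<^sub>R y) \<le> (1 - t) * g x + t * g y"
  proof (cases "x = y")
    case True
    then show ?thesis
      by (simp add: scaleR_left_diff_distrib left_diff_distrib)
  next
    case False
    then have "g ((1 - t) *\<^sub>R x + t *\<^sub>R y) < (1 - t) * g x + t * g y"
      using assms \<open>0 < t\<close> \<open>t < 1\<close> \<open>x \<in> S\<close> \<open>y \<in> S\<close> unfolding strictly_convex_on_def by simp
    then show ?thesis by simp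
  qed
qed (use assms strictly_convex_on_def in blast)

lemma has_real_derivative_gradient_comp:
  fixes g :: "'a::euclidean_space \<Rightarrow> real"
  assumes "g differentiable (at (z t))" "(z has_vector_derivative v) (at t within S)"
  shows "((\<lambda>s. g (z s)) has_real_derivative inner v (gradient g (z t))) (at t within S)"
proof -
  have "(g has_derivative (\<lambda>h. inner h (gradient g (z t)))) (at (z t))"
    using differentiable_imp_GDERIV_gradient[OF assms(1)] by (simp add: gderiv_def)
  from has_derivative_compose[OF assms(2)[unfolded has_vector_derivative_def] this] show ?thesis
    by (simp add: has_field_derivative_def mult_commute_abs)
qed

text \<open>The Fenchel-Young inequality at \<open>q\<close> and at \<open>- q\<close> bounds
  \<open>|<z, q>| - g z\<close> by the larger conjugate value. The comparison stays in
  \<open>ereal\<close>, as conjugates may be infinite, until both ends are real.\<close>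

lemma conjugate_bound_imp_inner_bound:
  fixes g :: "'a::real_inner \<Rightarrow> real"
  assumes "0 < a"
    and bound: "ereal a * max (convex_conjugate g q) (convex_conjugate g (- q)) \<le> ereal K"
  shows "a * \<bar>inner z q\<bar> \<le> a * g z + K"
proof -
  have "ereal (\<bar>inner z q\<bar> - g z) \<le> max (convex_conjugate g q) (convex_conjugate g (- q))"
    unfolding convex_conjugate_def
    by (cases "0 \<le> inner z q")
      (auto simp: le_max_iff_disj inner_minus_right intro: SUP_upper2[where i = z])
  then have "ereal a * ereal (\<bar>inner z q\<bar> - g z) \<le> ereal K"
    using bound ereal_mult_left_mono[of _ _ "ereal a"] \<open>0 < a\<close> by (meson ereal_less_eq(5) less_imp_le order_trans)
  then show ?thesis
    by (simp add: right_diff_distrib)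
qed

section \<open>One-variable calculus on the half-line\<close>

lemma nonpos_deriv_atLeast_imp_antimono:
  fixes g g' :: "real \<Rightarrow> real"
  assumes "\<And>t. a \<le> t \<Longrightarrow> (g has_real_derivative g' t) (at t within {a..})"
    and "\<And>t. a \<le> t \<Longrightarrow> g' t \<le> 0"
    and "a \<le> s" "s \<le> t"
  shows "g t \<le> g s"
proof (rule DERIV_nonpos_imp_decreasing_open[OF \<open>s \<le> t\<close>])
  show "continuous_on {s..t} g"
    by (rule continuous_on_subset[of "{a..}"])
      (use assms in \<open>auto intro!: DERIV_continuous_on\<close>)
  fix u assume "s < u" "u < t"
  then have "at u within {a..} = at u"
    using assms(3) by (intro at_within_interior) auto
  then show "\<exists>y. (g has_real_derivative y) (at u) \<and> y \<le> 0"
    using assms(1)[of u] assms(2)[of u] \<open>s < u\<close> \<open>a \<le> s\<close> by auto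
qed

lemma antimono_on_imp_deriv_nonpos:
  fixes g :: "real \<Rightarrow> real"
  assumes "antimono_on A g" "(g has_real_derivative d) (at y within A)" "y \<in> interior A"
  shows "d \<le> 0"
proof -
  have "mono_on A (\<lambda>z. - g z)"
    using assms(1) by (auto simp: monotone_on_def)
  from mono_on_imp_deriv_nonneg[OF this, of "- d" y] show ?thesis
    using assms(2,3) at_within_interior[of y A] by (auto intro: DERIV_minus)
qed

text \<open>Integrating factor: \<open>W\<close> times the exponential of \<open>c\<close> times the
  integral of \<open>h\<close> has zero derivative. The nonlinear comparison equation takes this
  linear form once \<open>\<alpha> (2 * W t)\<close> along the solution is regarded as the
  coefficient \<open>h\<close>.\<close>

lemma linear_ode_solution:
  fixes W h :: "real \<Rightarrow> real"
  assumes h: "continuous_on {0..} h"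
    and W: "\<And>t. 0 \<le> t \<Longrightarrow> (W has_real_derivative - c * h t * W t) (at t within {0..})"
    and "0 \<le> t"
  shows "W t = W 0 * exp (- c * integral {0..t} h)"
proof -
  define I where "I s = integral {0..s} h" for s
  define g where "g s = W s * exp (c * I s)" for s
  have I: "(I has_real_derivative h s) (at s within {0..t})" if "s \<in> {0..t}" for s
    unfolding I_def using that continuous_on_subset[OF h]
    by (intro integral_has_real_derivative) auto
  have "(g has_real_derivative 0) (at s within {0..t})" if "s \<in> {0..t}" for s
  proof -
    have "(W has_real_derivative - c * h s * W s) (at s within {0..t})"
      using DERIV_subset[OF W, of s "{0..t}"] that by auto
    then show ?thesis
      unfolding g_def using I[OF that]
      by (auto intro!: derivative_eq_intros)
  qed
  then have "g t = g 0"
    using has_field_derivative_zero_constant[of "{0..t}" g] \<open>0 \<le> t\<close> by force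
  moreover have "I 0 = 0"
    by (simp add: I_def)
  ultimately show ?thesis
    unfolding g_def I_def[symmetric] by (simp add: exp_minus field_simps)
qed

section \<open>Inequalities between energy and coupling term\<close>

lemma coupling_bound_antimono:
  fixes a b F K S :: real
  assumes "0 \<le> a" "a \<le> b" "0 \<le> F" "0 \<le> K" "b * \<bar>S\<bar> \<le> b * F + K"
  shows "a * \<bar>S\<bar> \<le> a * F + K"
\<comment> \<open>The bound says that the coefficient times the excess \<open>|S| - F\<close> is at
  most \<open>K\<close>. A nonpositive excess makes this trivial; a positive one makes it easier for
  the smaller coefficient.\<close>
proof (cases "\<bar>S\<bar> \<le> F")
  case True
  then show ?thesis
    using mult_left_mono[OF True \<open>0 \<le> a\<close>] \<open>0 \<le> K\<close> by simp
next
  case False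
  then have "a * (\<bar>S\<bar> - F) \<le> b * (\<bar>S\<bar> - F)"
    using assms(2) by (intro mult_right_mono) auto
  then show ?thesis
    using assms(5) by (simp add: algebra_simps)
qed

text \<open>This is positivity of the derivative of
  \<open>W - H - C / 2 * \<alpha> (2 * W) * S\<close> at its zeros, with \<open>a\<close> and
  \<open>a'\<close> the values of \<alpha> and its derivative at \<open>2 * w\<close>;
  \<open>P\<close> and \<open>Q\<close> stand for \<open><p, grad k>\<close> and
  \<open><x - xs, grad f>\<close>. With \<open>b = C / 2 * a\<close>, the value
  \<open>(1 - \<gamma>) * (b * w)\<close> separates the two sides.\<close>

lemma lyapunov_dissipation:
  fixes a a' \<gamma> C w F K S P Q :: real
  assumes \<gamma>: "0 < \<gamma>" "\<gamma> < 1" and C: "0 < C" "C \<le> \<gamma>"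
    and a: "0 < a" "a \<le> 1" and a': "a' \<le> 0" "- C * a' * (2 * w) < a"
    and FK: "0 \<le> F" "0 \<le> K" "0 < F + K" "F + K < 2 * w"
    and grad: "K \<le> P" "F \<le> Q"
    and S: "a * \<bar>S\<bar> \<le> a * F + K"
    and w: "w = F + K + C / 2 * a * S"
  shows "(1 - \<gamma>) * C / 4 * a * w * (1 - C * a' * S) < \<gamma> * P - C / 2 * a * (P - Q - \<gamma> * S)"
proof -
  define b where "b = C / 2 * a"
  have b: "0 < b" "b \<le> C / 2"
    using C a mult_left_mono[of a 1 "C / 2"] by (auto simp: b_def)
  have "a * F \<le> F"
    using a FK mult_right_mono[of a 1 F] by simp
  then have "a * \<bar>S\<bar> < 2 * w"
    using S FK by linarith
  \<comment> \<open>Since \<open>a * |S|\<close> lies below \<open>2 * w\<close>, the growth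
    condition on \<alpha> at \<open>2 * w\<close> controls \<open>a'\<close> times \<open>S\<close>,
    that is, the effect of the moving weight.\<close>
  then have "(- C * a') * (a * \<bar>S\<bar>) \<le> (- C * a') * (2 * w)"
    using C a' by (intro mult_left_mono) (auto simp: mult_nonneg_nonpos)
  then have "a * ((- C * a') * \<bar>S\<bar>) < a * 1"
    using a'(2) by (simp add: mult_ac)
  then have CaS: "(- C * a') * \<bar>S\<bar> < 1"
    using mult_less_cancel_left_pos[OF \<open>0 < a\<close>] by blast
  moreover have "- C * a' * S \<le> (- C * a') * \<bar>S\<bar>"
    using C a' by (intro mult_left_mono) (auto simp: mult_nonneg_nonpos)
  ultimately have D2: "1 - C * a' * S < 2"
    by simp
  have "0 < (1 - \<gamma>) * (b * w)"
    using \<gamma> b FK by simp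
  \<comment> \<open>Half of the constant 1/4 in the rate is used up in \<open>b\<close>; the other
    half absorbs the bound 2 on the last factor. Strictness of the conclusion arises here.\<close>
  then have "(1 - \<gamma>) * (b * w) * ((1 - C * a' * S) / 2) < (1 - \<gamma>) * (b * w) * 1"
    using D2 by (intro mult_strict_left_mono) auto
  then have lhs: "(1 - \<gamma>) * C / 4 * a * w * (1 - C * a' * S) < (1 - \<gamma>) * (b * w)"
    unfolding b_def by (simp add: mult_ac)
  \<comment> \<open>Collecting terms leaves \<open>P\<close> with coefficient
    \<open>\<gamma> - b\<close>, which is positive because
    \<open>b <= C / 2 <= \<gamma> / 2\<close>.\<close>
  have "(\<gamma> - b) * K \<le> (\<gamma> - b) * P" "b * F \<le> b * Q"
    using grad b C \<gamma> by (auto intro!: mult_left_mono)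
  then have rhs: "(\<gamma> - b) * K + b * F + b * \<gamma> * S \<le> \<gamma> * P - b * (P - Q - \<gamma> * S)"
    by (simp add: algebra_simps)
  have "(1 - \<gamma>) * (b * w) \<le> (\<gamma> - b) * K + b * F + b * \<gamma> * S"
  proof (cases "0 \<le> S")
    case True
    \<comment> \<open>For nonnegative \<open>S\<close> the coefficients of \<open>F\<close>,
      \<open>K\<close> and \<open>S\<close> are compared one by one.\<close>
    have 1: "(1 - \<gamma>) * b \<le> 1 * b"
      using \<gamma> b by (intro mult_right_mono) auto
    then have "(1 - \<gamma>) * b \<le> \<gamma>" "(1 - \<gamma>) * b \<le> \<gamma> - b"
      using b C by linarith+
    then have "(1 - \<gamma>) * b * (b * S) \<le> \<gamma> * (b * S)" "(1 - \<gamma>) * b * K \<le> (\<gamma> - b) * K"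
      using True b FK by (intro mult_right_mono; simp)+
    moreover have "(1 - \<gamma>) * b * F \<le> 1 * b * F"
      using FK by (intro mult_right_mono[OF 1])
    ultimately show ?thesis
      using w unfolding b_def[symmetric] by (simp add: algebra_simps)
  next
    case False
    \<comment> \<open>For negative \<open>S\<close> the term \<open>b * \<gamma> * S\<close> is
      charged to \<open>F\<close> and \<open>K\<close> by the coupling bound. The coefficient left
      for \<open>F\<close> is exactly \<open>(1 - \<gamma>) * b\<close>, which explains the factor
      \<open>1 - \<gamma>\<close> in the rate; for \<open>K\<close> there is room since
      \<open>b <= C / 2\<close> and \<open>C <= \<gamma>\<close>.\<close>
    have "\<gamma> * (C / 2) * (a * \<bar>S\<bar>) \<le> \<gamma> * (C / 2) * (a * F + K)"
      using S \<gamma> C by (intro mult_left_mono) auto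
    then have 1: "b * \<gamma> * \<bar>S\<bar> \<le> \<gamma> * b * F + \<gamma> * (C / 2) * K"
      unfolding b_def by (simp add: algebra_simps)
    have "(1 - \<gamma>) * b \<le> (1 - \<gamma>) * (C / 2)"
      using \<gamma> b by (intro mult_left_mono) auto
    then have "(1 - \<gamma>) * b \<le> \<gamma> - b - \<gamma> * (C / 2)"
      using C b by (simp add: left_diff_distrib)
    then have 2: "(1 - \<gamma>) * b * K \<le> (\<gamma> - b - \<gamma> * (C / 2)) * K"
      using FK by (intro mult_right_mono) auto
    have "b * S \<le> 0"
      using False b by (simp add: mult_nonneg_nonpos)
    then have "w \<le> F + K"
      using w unfolding b_def by simp
    then have "(1 - \<gamma>) * b * w \<le> (1 - \<gamma>) * b * (F + K)"
      using \<gamma> b by (intro mult_left_mono) auto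
    with 1 2 False show ?thesis
      by (simp add: algebra_simps)
  qed
  then show ?thesis
    using lhs rhs unfolding b_def by linarith
qed

theorem theorem2p5:
  fixes f k :: "real ^ 'd \<Rightarrow> real"
    and xs xi :: "real ^ 'd"
    and \<gamma> C lam H0 \<alpha>s :: real
    and \<alpha> \<alpha>' :: "real \<Rightarrow> real"
    and x p :: "real \<Rightarrow> real ^ 'd"
    and W :: "real \<Rightarrow> real"
  assumes f_diff: "\<forall>y. f differentiable (at y)"
    and f_convex: "convex_on UNIV f"
    and f_min: "unique_minimizer f xs"
    and k_diff: "\<forall>q. k differentiable (at q)"
    and k_convex: "strictly_convex_on UNIV k"
    and k_min: "is_arg_min k (\<lambda>_. True) 0" "k 0 = 0"
    and gamma: "0 < \<gamma>" "\<gamma> < 1"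
    and alpha_range: "\<forall>y\<ge>0. 0 < \<alpha> y \<and> \<alpha> y \<le> 1"
    and alpha_deriv: "\<forall>y\<ge>0. (\<alpha> has_real_derivative \<alpha>' y) (at y within {0..})"
    and alpha_noninc: "antimono_on {0..} \<alpha>"
    and alpha_convex: "convex_on {0..} \<alpha>"
    and C: "0 < C" "C \<le> \<gamma>"
    and k_lower: "\<forall>q. ereal (k q) \<ge> ereal (\<alpha> (k q)) *
        max (convex_conjugate (centered f xs) q) (convex_conjugate (centered f xs) (- q))"
    and alpha_C: "\<forall>y\<ge>0. - C * \<alpha>' y * y < \<alpha> y"
    and x_ode: "\<forall>t\<ge>0. (x has_vector_derivative gradient k (p t)) (at t within {0..})"
    and p_ode: "\<forall>t\<ge>0. (p has_vector_derivative (- gradient f (x t) - \<gamma> *\<^sub>R p t)) (at t within {0..})"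
    and init: "x 0 = xi" "p 0 = 0"
    and H0: "H0 = f (x 0) - f xs"
    and alpha_star: "\<alpha>s = \<alpha> (3 * H0)"
    and lam: "lam = (1 - \<gamma>) * C / 4"
    and W_nonneg: "\<forall>t\<ge>0. 0 \<le> W t"
    and W_ode: "\<forall>t\<ge>0. (W has_real_derivative (- lam * \<alpha> (2 * W t) * W t)) (at t within {0..})"
    and W_init: "W 0 = H0"
  shows "\<forall>t\<ge>0.
      f (x t) - f xs \<le> 2 * H0 * exp (- lam * integral {0..t} (\<lambda>s. \<alpha> (2 * W s))) \<and>
      2 * H0 * exp (- lam * integral {0..t} (\<lambda>s. \<alpha> (2 * W s))) \<le> 2 * H0 * exp (- lam * \<alpha>s * t)"
proof -

  \<comment> \<open>Signs, continuity and the comparison solution\<close>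
  have min_f: "f xs \<le> f z" for z
    using f_min unfolding unique_minimizer_def is_arg_min_linorder by simp
  have k_nonneg: "0 \<le> k q" for q
    using k_min by (simp add: is_arg_min_linorder)
  have \<alpha>: "0 < \<alpha> y" "\<alpha> y \<le> 1" if "0 \<le> y" for y
    using alpha_range that by auto
  have \<alpha>_anti: "\<alpha> z \<le> \<alpha> y" if "0 \<le> y" "y \<le> z" for y z
    using alpha_noninc that by (auto simp: monotone_on_def)
  have H0_nonneg: "0 \<le> H0"
    using H0 min_f by simp
  have lam_pos: "0 < lam"
    unfolding lam using gamma C by simp
  have cont_\<alpha>: "continuous_on {0..} \<alpha>"
    using alpha_deriv by (meson DERIV_continuous atLeast_iff continuous_on_eq_continuous_within)
  have cont_W: "continuous_on {0..} W"
    using W_ode by (meson DERIV_continuous atLeast_iff continuous_on_eq_continuous_within)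
  have cont_\<alpha>W: "continuous_on {0..} (\<lambda>s. \<alpha> (2 * W s))"
  proof (rule continuous_on_compose2[OF cont_\<alpha>])
    show "continuous_on {0..} (\<lambda>s. 2 * W s)"
      by (rule continuous_on_mult_left[OF cont_W])
    show "(\<lambda>s. 2 * W s) ` {0..} \<subseteq> {0..}"
      using W_nonneg by (simp add: image_subset_iff)
  qed
  have W_eq: "W t = H0 * exp (- lam * integral {0..t} (\<lambda>s. \<alpha> (2 * W s)))" if "0 \<le> t" for t
    using linear_ode_solution[OF cont_\<alpha>W _ that, of W lam] W_ode W_init by simp
  have W_le: "W t \<le> H0" if "0 \<le> t" for t
    using nonpos_deriv_atLeast_imp_antimono[of 0 W "\<lambda>t. - lam * \<alpha> (2 * W t) * W t" 0 t]
      W_ode W_init W_nonneg \<alpha> lam_pos that by (auto simp: less_imp_le)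

  \<comment> \<open>Energies and their coupling along the trajectory\<close>
  define F K S P Q where "F t = f (x t) - f xs" and "K t = k (p t)" and "S t = inner (x t - xs) (p t)"
    and "P t = inner (p t) (gradient k (p t))" and "Q t = inner (x t - xs) (gradient f (x t))" for t
  note defs = F_def K_def S_def P_def Q_def
  have FK_nonneg: "0 \<le> F t" "0 \<le> K t" for t
    using min_f k_nonneg by (auto simp: defs)
  \<comment> \<open>Here and for \<open>F_le\<close>, the tangent inequality is evaluated at the
    minimizer: 0 for \<open>k\<close> and \<open>xs\<close> for \<open>f\<close>.\<close>
  have K_le: "K t \<le> P t" for t
    using convex_on_imp_above_tangent_GDERIV[OF strictly_convex_on_imp_convex_on[OF k_convex]
        differentiable_imp_GDERIV_gradient[OF k_diff[rule_format]], of "p t" 0] k_min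
    by (simp add: defs)
  have F_le: "F t \<le> Q t" for t
    using convex_on_imp_above_tangent_GDERIV[OF f_convex
        differentiable_imp_GDERIV_gradient[OF f_diff[rule_format]], of "x t" xs]
    by (simp add: defs inner_diff_left)
  have S_bound: "\<alpha> (K t) * \<bar>S t\<bar> \<le> \<alpha> (K t) * F t + K t" for t
    using conjugate_bound_imp_inner_bound[OF \<alpha>(1) k_lower[rule_format], of "p t" "x t - xs"] k_nonneg
    by (simp add: defs centered_def)
  \<comment> \<open>The hypothesis provides the weight \<open>\<alpha> (K t)\<close>, whereas the
    barrier carries \<open>\<alpha> (2 * W t)\<close>; the smaller weight is reached by
    monotonicity.\<close>
  have S_bound': "\<alpha> y * \<bar>S t\<bar> \<le> \<alpha> y * F t + K t" if "K t \<le> y" for y t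
  proof (rule coupling_bound_antimono[OF _ _ FK_nonneg S_bound])
    show "0 \<le> \<alpha> y" "\<alpha> y \<le> \<alpha> (K t)"
      using \<alpha>(1)[of y] \<alpha>_anti that FK_nonneg(2)[of t] by (auto simp: less_imp_le)
  qed

  \<comment> \<open>Derivatives of the energy and of the coupling\<close>
  have H_deriv: "((\<lambda>t. F t + K t) has_real_derivative - \<gamma> * P t) (at t within {0..})" if "0 \<le> t" for t
  proof -
    have "((\<lambda>t. f (x t)) has_real_derivative inner (gradient k (p t)) (gradient f (x t))) (at t within {0..})"
      using f_diff x_ode that by (intro has_real_derivative_gradient_comp) auto
    moreover have "((\<lambda>t. k (p t)) has_real_derivative
        inner (- gradient f (x t) - \<gamma> *\<^sub>R p t) (gradient k (p t))) (at t within {0..})"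
      using k_diff p_ode that by (intro has_real_derivative_gradient_comp) auto
    \<comment> \<open>The inner products of the two gradients cancel, so only the friction term
      survives.\<close>
    ultimately show ?thesis
      unfolding defs
      by (auto intro!: derivative_eq_intros simp: inner_diff_right inner_commute)
  qed
  have S_deriv: "(S has_real_derivative P t - Q t - \<gamma> * S t) (at t within {0..})" if "0 \<le> t" for t
  proof -
    have "(S has_derivative (\<lambda>h. inner (x t - xs) (h *\<^sub>R (- gradient f (x t) - \<gamma> *\<^sub>R p t))
        + inner (h *\<^sub>R gradient k (p t)) (p t))) (at t within {0..})"
      unfolding S_def[abs_def]
      using x_ode p_ode that
      by (auto intro!: derivative_eq_intros simp: has_vector_derivative_def)
    then show ?thesis
      unfolding has_field_derivative_def
      by (rule has_derivative_eq_rhs)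
        (simp add: defs fun_eq_iff inner_diff_right inner_commute algebra_simps)
  qed
  have H_anti: "F t + K t \<le> F s + K s" if "0 \<le> s" "s \<le> t" for s t
  proof -
    have "- \<gamma> * P u \<le> 0" for u
      using gamma K_le[of u] FK_nonneg(2)[of u] by simp
    then show ?thesis
      using nonpos_deriv_atLeast_imp_antimono[OF H_deriv _ that] by blast
  qed

  \<comment> \<open>Barrier comparison with \<open>W\<close>\<close>
  define \<phi> where "\<phi> t = W t - (F t + K t) - C / 2 * \<alpha> (2 * W t) * S t" for t
  define \<psi> where "\<psi> t = 2 * W t - (F t + K t)" for t
  have cont_H: "continuous_on {0..} (\<lambda>t. F t + K t)"
    using DERIV_continuous[OF H_deriv] by (simp add: continuous_on_eq_continuous_within)
  have cont_\<psi>: "continuous_on {0..} \<psi>"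
    unfolding \<psi>_def[abs_def] by (rule continuous_on_diff[OF continuous_on_mult_left[OF cont_W] cont_H])
  have cont_S: "continuous_on {0..} S"
    using DERIV_continuous[OF S_deriv] by (simp add: continuous_on_eq_continuous_within)
  have cont_\<phi>: "continuous_on {0..} \<phi>"
    unfolding \<phi>_def[abs_def]
    by (rule continuous_on_diff[OF continuous_on_diff[OF cont_W cont_H]
          continuous_on_mult[OF continuous_on_mult_left[OF cont_\<alpha>W] cont_S]])

  have F_bound: "F t \<le> 2 * W t" if "0 \<le> t" for t
  proof (cases "F t + K t = 0")
    case True
    then show ?thesis
      using FK_nonneg[of t] W_nonneg[rule_format, OF that] by linarith
  next
    case False
    \<comment> \<open>The energy is non-increasing, so a nonzero value at \<open>t\<close> forces
      positive values before \<open>t\<close>; the strict inequalities below rest on this.\<close>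
    have H_pos: "0 < F s + K s" if "0 \<le> s" "s < t" for s
      using H_anti[OF that(1) less_imp_le[OF that(2)]] False FK_nonneg[of t] by linarith
    have "0 \<le> \<phi> t \<and> 0 \<le> \<psi> t"
    proof (rule coupled_barrier[OF cont_\<phi> cont_\<psi>, of t])
      \<comment> \<open>Zero initial momentum makes both \<open>K\<close> and \<open>S\<close>
        vanish, so \<phi> starts exactly at 0 and the derivative condition already matters at the
        initial time.\<close>
      have "p 0 = 0" "K 0 = 0" "F 0 = H0" "S 0 = 0"
        using init k_min H0 by (auto simp: defs)
      then show "0 \<le> \<phi> 0" "0 \<le> \<psi> 0"
        using W_init H0_nonneg by (auto simp: \<phi>_def \<psi>_def)
      show "t \<in> {0..t}"
        using that by simp
    next
      fix s assume s: "0 \<le> s" "s < t" "0 \<le> \<phi> s" "0 \<le> \<psi> s"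
      let ?a = "\<alpha> (2 * W s)"
      \<comment> \<open>The coupling term is at most \<open>C / 2\<close> times the energy in
        absolute value, hence below half of it because \<open>C <= \<gamma> < 1\<close>. Then
        \<open>\<phi> s >= 0\<close> puts \<open>W s\<close> strictly above half the energy.\<close>
      have "?a * \<bar>S s\<bar> \<le> ?a * F s + K s"
        using s(4) FK_nonneg[of s] by (intro S_bound') (simp add: \<psi>_def)
      moreover have "?a * F s \<le> 1 * F s"
        using \<alpha>(2)[of "2 * W s"] W_nonneg[rule_format, OF s(1)] FK_nonneg[of s] by (intro mult_right_mono) auto
      ultimately have "?a * \<bar>S s\<bar> \<le> F s + K s"
        by simp
      then have "C / 2 * (?a * \<bar>S s\<bar>) \<le> C / 2 * (F s + K s)"
        using C by (intro mult_left_mono) auto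
      also have "\<dots> < 1 / 2 * (F s + K s)"
        using C gamma H_pos[OF s(1,2)] by (intro mult_strict_right_mono) auto
      finally have "C / 2 * (?a * \<bar>S s\<bar>) < (F s + K s) / 2"
        by simp
      moreover have "- (C / 2 * (?a * \<bar>S s\<bar>)) \<le> C / 2 * (?a * S s)"
      proof -
        have "C / 2 * (?a * (- S s)) \<le> C / 2 * (?a * \<bar>S s\<bar>)"
          using C \<alpha>(1)[of "2 * W s"] W_nonneg[rule_format, OF s(1)] by (intro mult_left_mono) auto
        then show ?thesis
          by simp
      qed
      ultimately show "0 < \<psi> s"
        using s(3) by (simp add: \<phi>_def \<psi>_def mult.assoc)
    next
      fix s assume s: "0 \<le> s" "s < t" "\<phi> s = 0" "0 < \<psi> s"
      let ?a = "\<alpha> (2 * W s)" and ?a' = "\<alpha>' (2 * W s)"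
      let ?W' = "- lam * ?a * W s"
      \<comment> \<open>Positivity places \<open>2 * W s\<close> in the interior of the half-line,
        where monotonicity of \<alpha> determines the sign of its derivative.\<close>
      have W_pos: "0 < W s"
        using s(4) H_pos[OF s(1,2)] by (simp add: \<psi>_def)
      have \<alpha>_deriv: "(\<alpha> has_real_derivative ?a') (at (2 * W s) within {0..})"
        using alpha_deriv W_pos by simp
      have \<alpha>': "?a' \<le> 0"
        by (rule antimono_on_imp_deriv_nonpos[OF alpha_noninc \<alpha>_deriv]) (use W_pos in simp)
      have "((\<lambda>s. 2 * W s) has_real_derivative 2 * ?W') (at s within {0..})"
        using W_ode s(1) by (intro DERIV_cmult) auto
      moreover have "(\<lambda>s. 2 * W s) ` {0..} \<subseteq> {0..}"
        using W_nonneg by (simp add: image_subset_iff)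
      ultimately have \<alpha>W_deriv: "((\<lambda>s. \<alpha> (2 * W s)) has_real_derivative ?a' * (2 * ?W')) (at s within {0..})"
        using DERIV_image_chain[of \<alpha> ?a' "\<lambda>s. 2 * W s" s "{0..}" "2 * ?W'"]
          DERIV_subset[OF \<alpha>_deriv] by (simp add: o_def)
      have "(\<phi> has_real_derivative ?W' - (- \<gamma> * P s)
          - C / 2 * (?a' * (2 * ?W') * S s + ?a * (P s - Q s - \<gamma> * S s))) (at s within {0..})"
        unfolding \<phi>_def[abs_def]
        by (rule DERIV_cong[OF DERIV_diff[OF DERIV_diff[OF W_ode[rule_format, OF s(1)] H_deriv[OF s(1)]]
                DERIV_mult[OF DERIV_cmult[OF \<alpha>W_deriv] S_deriv[OF s(1)]]]])
          (simp add: field_simps)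
      \<comment> \<open>The two occurrences of \<open>?W'\<close> in the derivative of \<phi>
        combine into \<open>?W' * (1 - C * ?a' * S s)\<close>, so this inequality says precisely
        that the derivative is positive.\<close>
      moreover have "lam * ?a * W s * (1 - C * ?a' * S s) < \<gamma> * P s - C / 2 * ?a * (P s - Q s - \<gamma> * S s)"
        unfolding lam
      proof (rule lyapunov_dissipation)
        show "?a * \<bar>S s\<bar> \<le> ?a * F s + K s"
          using s(4) FK_nonneg[of s] by (intro S_bound') (simp add: \<psi>_def)
        show "- C * ?a' * (2 * W s) < ?a"
          using alpha_C W_pos by simp
        show "F s + K s < 2 * W s" "W s = F s + K s + C / 2 * ?a * S s"
          using s(3,4) by (auto simp: \<phi>_def \<psi>_def)
      qed (use gamma C \<alpha>[of "2 * W s"] \<alpha>' W_pos FK_nonneg[of s] K_le[of s] F_le[of s] H_pos[OF s(1,2)] in auto)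
      then have "0 < ?W' - (- \<gamma> * P s) - C / 2 * (?a' * (2 * ?W') * S s + ?a * (P s - Q s - \<gamma> * S s))"
        by (simp add: field_simps)
      ultimately show "\<exists>d>0. (\<phi> has_real_derivative d) (at s within {0..})"
        by blast
    qed
    then show ?thesis
      using FK_nonneg(2)[of t] by (simp add: \<psi>_def)
  qed

  \<comment> \<open>From the barrier to the two exponential bounds\<close>
  show ?thesis
  proof (intro allI impI conjI)
    fix t :: real assume t: "0 \<le> t"
    show "f (x t) - f xs \<le> 2 * H0 * exp (- lam * integral {0..t} (\<lambda>s. \<alpha> (2 * W s)))"
      using F_bound[OF t] W_eq[OF t] by (simp add: F_def)
    have "integral {0..t} (\<lambda>s. \<alpha>s) \<le> integral {0..t} (\<lambda>s. \<alpha> (2 * W s))"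
    proof (rule integral_le)
      show "(\<lambda>s. \<alpha> (2 * W s)) integrable_on {0..t}"
        by (intro integrable_continuous_real continuous_on_subset[OF cont_\<alpha>W]) auto
      fix s assume s: "s \<in> {0..t}"
      \<comment> \<open>Here \<open>2 * W s <= 2 * H0 <= 3 * H0\<close>, and \<alpha> is
        non-increasing.\<close>
      then show "\<alpha>s \<le> \<alpha> (2 * W s)"
        unfolding alpha_star using W_le[of s] W_nonneg[rule_format, of s] H0_nonneg by (intro \<alpha>_anti) auto
    qed auto
    then have "lam * \<alpha>s * t \<le> lam * integral {0..t} (\<lambda>s. \<alpha> (2 * W s))"
      using t lam_pos by (simp add: mult_ac)
    then show "2 * H0 * exp (- lam * integral {0..t} (\<lambda>s. \<alpha> (2 * W s))) \<le> 2 * H0 * exp (- lam * \<alpha>s * t)"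
      using H0_nonneg by (intro mult_left_mono) auto
  qed
qed

end
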